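(* Let $P=(P,\sqsubseteq)$ be a poset. The antichain completion $\mathscr A(P)$ is a $\vee$-semilattice, in which the join of $A,B\in\mathscr A(P)$ is the set of maximal elements of $A\cup B$. Moreover, the $\vee$-irreducible elements of $\mathscr A(P)$ are the singleton antichains, and for every $A\in\mathscr A(P)$, \[A=\bigvee_{x\in A}\{x\}\] is the unique irredundant representation of $A$ as a join of a set of $\vee$-irreducible elements.
   Context: For $X\subseteq P$, $\downarrow X=\{y\in P:\exists x\in X,\ y\sqsubseteq x\}$. $\mathscr A(P)$ is the set of antichains of $P$ ordered by $A\le B$ iff $\downarrow A\subseteq\downarrow B$ (equivalently, for every $x\in A$ there is $y\in B$ with $x\sqsubseteq y$). An element $x$ of a $\vee$-semilattice, different from the least element (if any), is $\vee$-irreducible if $x=a\vee b$ implies $x=a$ or $x=b$. A representation $A=\bigvee X$ (the join existing) with $X$ a set of $\vee$-irreducible elements is irredundant if $\bigvee Y\ne A$ for every proper subset $Y\subsetneq X$. *)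

theory Defs
  imports "HOL-Algebra.Lattice"
begin

definition down_closure :: "('a, 'b) gorder_scheme \<Rightarrow> 'a set \<Rightarrow> 'a set" where
  "down_closure P X = {y \<in> carrier P. \<exists>x\<in>X. y \<sqsubseteq>\<^bsub>P\<^esub> x}"

definition maximal_elements :: "('a, 'b) gorder_scheme \<Rightarrow> 'a set \<Rightarrow> 'a set" where
  "maximal_elements P X = {x \<in> X. \<forall>y\<in>X. x \<sqsubseteq>\<^bsub>P\<^esub> y \<longrightarrow> y = x}"

text \<open>Antichains may be empty or infinite.\<close>

definition antichains :: "('a, 'b) gorder_scheme \<Rightarrow> 'a set set" where
  "antichains P =
    {A. A \<subseteq> carrier P \<and> (\<forall>x\<in>A. \<forall>y\<in>A. x \<noteq> y \<longrightarrow> \<not> x \<sqsubseteq>\<^bsub>P\<^esub> y \<and> \<not> y \<sqsubseteq>\<^bsub>P\<^esub> x)}"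

definition antichain_completion :: "('a, 'b) gorder_scheme \<Rightarrow> 'a set gorder" where
  "antichain_completion P =
    \<lparr>carrier = antichains P, eq = (=), le = (\<lambda>A B. down_closure P A \<subseteq> down_closure P B)\<rparr>"

definition join_irreducible :: "('a, 'b) gorder_scheme \<Rightarrow> 'a \<Rightarrow> bool" where
  "join_irreducible L x \<longleftrightarrow>
     x \<in> carrier L \<and> \<not> least L x (carrier L) \<and>
     (\<forall>a\<in>carrier L. \<forall>b\<in>carrier L. x = a \<squnion>\<^bsub>L\<^esub> b \<longrightarrow> x = a \<or> x = b)"

text \<open>
  The operator \<open>\<Squnion>\<^bsub>L\<^esub>\<close> returns an arbitrary value when no least upper bound exists, so
  ``the join of \<open>X\<close> exists and equals \<open>x\<close>'' is expressed by \<^term>\<open>least L x (Upper L X)\<close>.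
  In particular a subset without a join does not represent \<open>x\<close>.
\<close>

definition join_representation :: "('a, 'b) gorder_scheme \<Rightarrow> 'a set \<Rightarrow> 'a \<Rightarrow> bool" where
  "join_representation L X x \<longleftrightarrow>
     (\<forall>a\<in>X. join_irreducible L a) \<and> least L x (Upper L X)"

definition irredundant_representation :: "('a, 'b) gorder_scheme \<Rightarrow> 'a set \<Rightarrow> 'a \<Rightarrow> bool" where
  "irredundant_representation L X x \<longleftrightarrow>
     join_representation L X x \<and> (\<forall>Y. Y \<subset> X \<longrightarrow> \<not> least L x (Upper L Y))"

end

theory Submission
  imports Defs
begin

text \<open>
  The set \<open>A \<union> B\<close> has the same down-closure as its maximal elements, because no chain of three
  distinct elements fits into a union of two antichains. In an irredundant representation by
  singletons, the underlying set of points is an antichain (a point below another one could be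
  dropped without changing the upper bounds). Such an antichain is itself the least upper bound,
  hence equal to the represented element.
\<close>

section \<open>Antichains in an arbitrary poset\<close>

lemma antichainsD:
  assumes "A \<in> antichains P"
  shows "A \<subseteq> carrier P" and "\<And>x y. \<lbrakk>x \<in> A; y \<in> A; x \<sqsubseteq>\<^bsub>P\<^esub> y\<rbrakk> \<Longrightarrow> x = y"
  using assms unfolding antichains_def by auto

lemma antichainsI:
  assumes "A \<subseteq> carrier P" and "\<And>x y. \<lbrakk>x \<in> A; y \<in> A; x \<sqsubseteq>\<^bsub>P\<^esub> y\<rbrakk> \<Longrightarrow> x = y"
  shows "A \<in> antichains P"
  using assms unfolding antichains_def by auto

lemma antichains_mono: "\<lbrakk>A \<in> antichains P; B \<subseteq> A\<rbrakk> \<Longrightarrow> B \<in> antichains P"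
  unfolding antichains_def by blast

lemma singleton_antichain: "x \<in> carrier P \<Longrightarrow> {x} \<in> antichains P"
  unfolding antichains_def by simp

lemma carrier_antichain_completion [simp]:
  "carrier (antichain_completion P) = antichains P"
  by (simp add: antichain_completion_def)

context partial_order
begin

text \<open>As introduction rules, these facts make the classical reasoner loop.\<close>

declare le_antisym [rule del] le_cong_l [rule del] le_cong_r [rule del] weak_refl [rule del]

text \<open>Antisymmetry makes least elements unique, so the choice in \<open>sup_def\<close> has
  only one possible value.\<close>

lemma sup_eqI:
  assumes "least L x (Upper L X)"
  shows "\<Squnion>X = x"
  unfolding sup_def by (rule some_equality, rule assms, rule least_unique[OF _ assms])

text \<open>Removing an element below another member of \<open>X\<close> does not change the upper bounds of \<open>X\<close>.\<close>

lemma irredundant_representation_antichain: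
  assumes irr: "irredundant_representation L X x"
  shows "X \<in> antichains L"
proof (rule antichainsI)
  show sub: "X \<subseteq> carrier L"
    using irr
    unfolding irredundant_representation_def join_representation_def join_irreducible_def by blast
  fix a b assume ab: "a \<in> X" "b \<in> X" "a \<sqsubseteq> b"
  show "a = b"
  proof (rule ccontr)
    assume "a \<noteq> b"
    then have "b \<in> X - {a}" using ab by blast
    have "u \<in> Upper L X" if u: "u \<in> Upper L (X - {a})" for u
    proof -
      have "u \<in> carrier L" and le: "\<And>c. c \<in> X - {a} \<Longrightarrow> c \<sqsubseteq> u"
        using u sub unfolding Upper_def by auto
      moreover have "a \<sqsubseteq> u"
        by (rule le_trans[OF ab(3) le[OF \<open>b \<in> X - {a}\<close>]])
          (use ab sub \<open>u \<in> carrier L\<close> in auto)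
      ultimately show ?thesis
        unfolding Upper_def by auto
    qed
    then have "Upper L (X - {a}) = Upper L X"
      unfolding Upper_def by auto
    moreover have "X - {a} \<subset> X" using ab by blast
    ultimately show False
      using irr unfolding irredundant_representation_def join_representation_def by metis
  qed
qed

section \<open>The order on the antichain completion, expressed pointwise\<close>

lemma down_closure_subset_iff:
  assumes "A \<subseteq> carrier L" and "B \<subseteq> carrier L"
  shows "down_closure L A \<subseteq> down_closure L B \<longleftrightarrow> (\<forall>x\<in>A. \<exists>y\<in>B. x \<sqsubseteq> y)"
proof
  assume "down_closure L A \<subseteq> down_closure L B"
  then show "\<forall>x\<in>A. \<exists>y\<in>B. x \<sqsubseteq> y"
    using assms unfolding down_closure_def by blast
next
  assume *: "\<forall>x\<in>A. \<exists>y\<in>B. x \<sqsubseteq> y"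
  show "down_closure L A \<subseteq> down_closure L B"
  proof
    fix z assume "z \<in> down_closure L A"
    then obtain x where "z \<in> carrier L" "x \<in> A" "z \<sqsubseteq> x"
      unfolding down_closure_def by blast
    moreover from * \<open>x \<in> A\<close> obtain y where "y \<in> B" "x \<sqsubseteq> y" by blast
    ultimately show "z \<in> down_closure L B"
      using assms le_trans[of z x y] unfolding down_closure_def by blast
  qed
qed

lemma antichain_le_iff:
  assumes "A \<in> antichains L" and "B \<in> antichains L"
  shows "A \<sqsubseteq>\<^bsub>antichain_completion L\<^esub> B \<longleftrightarrow> (\<forall>x\<in>A. \<exists>y\<in>B. x \<sqsubseteq> y)"
  using down_closure_subset_iff[of A B] antichainsD(1)[OF assms(1)] antichainsD(1)[OF assms(2)]
  by (simp add: antichain_completion_def)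

text \<open>Going up from \<open>x\<close> in \<open>A\<close> to \<open>y\<close> in
  \<open>B\<close> and on to \<open>z\<close> in \<open>A\<close> must return to \<open>x\<close>,
  so \<open>y\<close> is squeezed between \<open>x\<close> and itself. Used in both directions, this
  gives antisymmetry.\<close>

lemma antichain_subset_if_le_le:
  assumes A: "A \<in> antichains L" and B: "B \<in> antichains L"
    and "A \<sqsubseteq>\<^bsub>antichain_completion L\<^esub> B" and "B \<sqsubseteq>\<^bsub>antichain_completion L\<^esub> A"
  shows "A \<subseteq> B"
proof
  fix x assume "x \<in> A"
  obtain y where y: "y \<in> B" "x \<sqsubseteq> y"
    using assms \<open>x \<in> A\<close> antichain_le_iff by blast
  obtain z where z: "z \<in> A" "y \<sqsubseteq> z"
    using assms y antichain_le_iff by blast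
  have carr: "x \<in> carrier L" "y \<in> carrier L" "z \<in> carrier L"
    using antichainsD(1)[OF A] antichainsD(1)[OF B] \<open>x \<in> A\<close> y z by auto
  have "x = z"
    using antichainsD(2)[OF A \<open>x \<in> A\<close> z(1)] le_trans[OF y(2) z(2)] carr by blast
  then have "x = y"
    using le_antisym y(2) z(2) carr by blast
  then show "x \<in> B"
    using y by simp
qed

text \<open>Reflexivity and transitivity are inherited from inclusion of down-closures; only
  antisymmetry depends on the elements being antichains.\<close>

lemma partial_order_antichain_completion: "partial_order (antichain_completion L)"
proof -
  have "eq (antichain_completion L) = (=)"
    by (simp add: antichain_completion_def)
  moreover have "A = B"
    if "A \<in> antichains L" "B \<in> antichains L"
      "A \<sqsubseteq>\<^bsub>antichain_completion L\<^esub> B" "B \<sqsubseteq>\<^bsub>antichain_completion L\<^esub> A" for A B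
    using antichain_subset_if_le_le that by blast
  ultimately show ?thesis
    by unfold_locales (auto simp: antichain_completion_def)
qed

text \<open>The facts above, notably \<open>irredundant_representation_antichain\<close>, become
  available one level up, for families of antichains in place of sets of points.\<close>

interpretation completion: partial_order "antichain_completion L"
  by (rule partial_order_antichain_completion)

section \<open>Binary joins\<close>

lemma maximal_elements_Un_antichain:
  assumes "A \<in> antichains L" and "B \<in> antichains L"
  shows "maximal_elements L (A \<union> B) \<in> antichains L"
  using antichainsD(1)[OF assms(1)] antichainsD(1)[OF assms(2)]
  by (intro antichainsI) (auto simp: maximal_elements_def)

text \<open>Maximal elements exist here without any finiteness: if nothing in \<open>B\<close> is
  above \<open>x\<close>, then \<open>x\<close> itself is maximal. Otherwise any \<open>y\<close> in
  \<open>B\<close> above \<open>x\<close> is maximal, because a further element \<open>z\<close> of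
  \<open>A\<close> above \<open>y\<close> would be above \<open>x\<close> and hence equal to
  it.\<close>

lemma maximal_elements_Un_above:
  assumes A: "A \<in> antichains L" and B: "B \<in> antichains L" and x: "x \<in> A"
  shows "\<exists>y\<in>maximal_elements L (A \<union> B). x \<sqsubseteq> y"
proof (cases "\<exists>y\<in>B. x \<sqsubseteq> y")
  case True
  then obtain y where y: "y \<in> B" "x \<sqsubseteq> y" by blast
  have "z = y" if z: "z \<in> A \<union> B" "y \<sqsubseteq> z" for z
  proof (cases "z \<in> B")
    case True
    then show ?thesis
      using antichainsD(2)[OF B y(1) True z(2)] by simp
  next
    case False
    then have "z \<in> A" using z by simp
    have carr: "x \<in> carrier L" "y \<in> carrier L" "z \<in> carrier L"
      using antichainsD(1)[OF A] antichainsD(1)[OF B] x y \<open>z \<in> A\<close> by auto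
    have "x = z"
      using antichainsD(2)[OF A x \<open>z \<in> A\<close>] le_trans[OF y(2) z(2)] carr by blast
    then show ?thesis
      using le_antisym y(2) z(2) carr by blast
  qed
  then show ?thesis
    using y unfolding maximal_elements_def by auto
next
  case False
  then have "x \<in> maximal_elements L (A \<union> B)"
    using x antichainsD(2)[OF A x] unfolding maximal_elements_def by auto
  then show ?thesis
    using x antichainsD(1)[OF A] by auto
qed

lemma least_Upper_maximal_elements_Un:
  assumes A: "A \<in> antichains L" and B: "B \<in> antichains L"
  shows "least (antichain_completion L) (maximal_elements L (A \<union> B))
    (Upper (antichain_completion L) {A, B})"
proof (rule least_UpperI)
  note M = maximal_elements_Un_antichain[OF A B]
  fix C assume "C \<in> {A, B}"
  then show "C \<sqsubseteq>\<^bsub>antichain_completion L\<^esub> maximal_elements L (A \<union> B)"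
    using maximal_elements_Un_above[OF A B] maximal_elements_Un_above[OF B A] A B M
    by (auto simp: antichain_le_iff Un_commute)
next
  note M = maximal_elements_Un_antichain[OF A B]
  fix U assume "U \<in> Upper (antichain_completion L) {A, B}"
  then have "U \<in> antichains L" "A \<sqsubseteq>\<^bsub>antichain_completion L\<^esub> U"
    "B \<sqsubseteq>\<^bsub>antichain_completion L\<^esub> U"
    using A B by (auto simp: Upper_def)
  \<comment> \<open>Each maximal element comes from \<open>A\<close> or \<open>B\<close> and is
    therefore already below a member of \<open>U\<close>.\<close>
  then show "maximal_elements L (A \<union> B) \<sqsubseteq>\<^bsub>antichain_completion L\<^esub> U"
    using A B M by (auto simp: antichain_le_iff maximal_elements_def)
qed (use A B maximal_elements_Un_antichain in auto)

lemma upper_semilattice_antichain_completion: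
  "upper_semilattice (antichain_completion L)"
  by unfold_locales (use least_Upper_maximal_elements_Un in auto)

lemma join_antichain_completion:
  assumes "A \<in> antichains L" and "B \<in> antichains L"
  shows "A \<squnion>\<^bsub>antichain_completion L\<^esub> B = maximal_elements L (A \<union> B)"
  unfolding join_def
  by (rule completion.sup_eqI) (rule least_Upper_maximal_elements_Un[OF assms])

section \<open>Join-irreducible antichains\<close>

lemma least_antichain_iff:
  "least (antichain_completion L) A (antichains L) \<longleftrightarrow> A = {}"
proof -
  have e: "{} \<in> antichains L"
    by (auto intro: antichainsI)
  show ?thesis
    \<comment> \<open>The empty antichain is vacuously below all others, and nothing but itself is
      below it.\<close>
    using e antichain_le_iff by (force simp: least_def)
qed

lemma join_irreducible_singleton:
  assumes x: "x \<in> carrier L"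
  shows "join_irreducible (antichain_completion L) {x}"
  unfolding join_irreducible_def carrier_antichain_completion
proof (intro conjI ballI impI)
  show "{x} \<in> antichains L" using x by (rule singleton_antichain)
  show "\<not> least (antichain_completion L) {x} (antichains L)"
    by (simp add: least_antichain_iff)
  fix A B
  assume A: "A \<in> antichains L" and B: "B \<in> antichains L"
    and eq: "{x} = A \<squnion>\<^bsub>antichain_completion L\<^esub> B"
  have max: "maximal_elements L (A \<union> B) = {x}"
    using eq join_antichain_completion[OF A B] by simp
  \<comment> \<open>\<open>C\<close> is whichever joinand contains \<open>x\<close>. All its
    elements are below the only maximal element \<open>x\<close>, so the antichain \<open>C\<close>
    has no room for a second point.\<close>
  have below: "C = {x}" if "C = A \<or> C = B" "x \<in> C" for C
  proof -
    have C: "C \<in> antichains L" using that A B by auto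
    have "\<exists>z\<in>maximal_elements L (A \<union> B). y \<sqsubseteq> z" if "y \<in> C" for y
      using \<open>C = A \<or> C = B\<close> that maximal_elements_Un_above[OF A B, of y]
        maximal_elements_Un_above[OF B A, of y, unfolded Un_commute[of B A]]
      by metis
    then have "y \<sqsubseteq> x" if "y \<in> C" for y
      using that by (simp add: max)
    then have "C \<subseteq> {x}"
      using antichainsD(2)[OF C _ \<open>x \<in> C\<close>] by (simp add: subset_iff)
    then show ?thesis
      using \<open>x \<in> C\<close> by auto
  qed
  have "x \<in> maximal_elements L (A \<union> B)"
    by (simp add: max)
  then have "x \<in> A \<or> x \<in> B"
    by (simp add: maximal_elements_def)
  then show "{x} = A \<or> {x} = B"
    using below[of A] below[of B] by auto
qed

text \<open>Splitting off a point \<open>x\<close> writes \<open>A\<close> as the join of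
  \<open>{x}\<close> and \<open>A - {x}\<close>. The second joinand lacks \<open>x\<close>, so
  irreducibility forces \<open>A = {x}\<close>.\<close>

lemma singleton_if_join_irreducible:
  assumes irr: "join_irreducible (antichain_completion L) A"
  shows "\<exists>x\<in>carrier L. A = {x}"
proof -
  have A: "A \<in> antichains L" and "A \<noteq> {}"
    using irr by (auto simp: join_irreducible_def least_antichain_iff)
  then obtain x where x: "x \<in> A" by blast
  have carr: "x \<in> carrier L" using x antichainsD(1)[OF A] by blast
  have R: "A - {x} \<in> antichains L"
    by (rule antichains_mono[OF A]) auto
  have S: "{x} \<in> antichains L"
    using singleton_antichain[OF carr] .
  have "{x} \<union> (A - {x}) = A" using x by blast
  moreover have "maximal_elements L A = A"
    using antichainsD(2)[OF A] by (auto simp: maximal_elements_def)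
  ultimately have "A = {x} \<squnion>\<^bsub>antichain_completion L\<^esub> (A - {x})"
    using join_antichain_completion[OF S R] by simp
  then have "A = {x} \<or> A = A - {x}"
    using irr S R unfolding join_irreducible_def carrier_antichain_completion by blast
  then show ?thesis
    using x carr by blast
qed

section \<open>Irredundant representations by singletons\<close>

lemma least_Upper_singletons:
  assumes A: "A \<in> antichains L"
  shows "least (antichain_completion L) A (Upper (antichain_completion L) {{x} | x. x \<in> A})"
proof (rule least_UpperI)
  show sub: "{{x} | x. x \<in> A} \<subseteq> carrier (antichain_completion L)"
    using antichainsD(1)[OF A] by (auto intro!: singleton_antichain)
  show "C \<sqsubseteq>\<^bsub>antichain_completion L\<^esub> A" if C: "C \<in> {{x} | x. x \<in> A}" for C
  proof -
    obtain x where x: "x \<in> A" "C = {x}" using C by blast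
    moreover have "x \<in> carrier L" using x antichainsD(1)[OF A] by blast
    ultimately show ?thesis
      using antichain_le_iff[OF singleton_antichain A, of x] le_refl by blast
  qed
  fix U assume "U \<in> Upper (antichain_completion L) {{x} | x. x \<in> A}"
  then have U: "U \<in> antichains L"
    and le: "\<And>x. x \<in> A \<Longrightarrow> {x} \<sqsubseteq>\<^bsub>antichain_completion L\<^esub> U"
    using sub by (auto simp: Upper_def)
  \<comment> \<open>Bounding every \<open>{x}\<close> by \<open>U\<close> is the pointwise form of
    bounding \<open>A\<close> by \<open>U\<close>, whatever the size of \<open>A\<close>.\<close>
  have "\<exists>y\<in>U. x \<sqsubseteq> y" if "x \<in> A" for x
    using le[OF that] that U antichainsD(1)[OF A]
      antichain_le_iff[OF singleton_antichain[of x] U] by blast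
  then show "A \<sqsubseteq>\<^bsub>antichain_completion L\<^esub> U"
    using antichain_le_iff[OF A U] by blast
qed (use A in simp)

lemma irredundant_representation_singletons:
  assumes A: "A \<in> antichains L"
  shows "irredundant_representation (antichain_completion L) {{x} | x. x \<in> A} A"
  unfolding irredundant_representation_def join_representation_def
proof (intro conjI allI impI ballI)
  show "least (antichain_completion L) A (Upper (antichain_completion L) {{x} | x. x \<in> A})"
    by (rule least_Upper_singletons[OF A])
  show "join_irreducible (antichain_completion L) C" if "C \<in> {{x} | x. x \<in> A}" for C
    using that antichainsD(1)[OF A] join_irreducible_singleton by auto
  fix Y assume Y: "Y \<subset> {{x} | x. x \<in> A}"
  \<comment> \<open>The points kept by \<open>Y\<close> form an antichain \<open>B\<close>, which is
    the join of \<open>Y\<close>. If \<open>A\<close> were that join too, then \<open>B = A\<close>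
    and \<open>Y\<close> would not be proper.\<close>
  define B where "B = {x \<in> A. {x} \<in> Y}"
  have YB: "Y = {{x} | x. x \<in> B}"
    using Y unfolding B_def by blast
  have "B \<in> antichains L"
    by (rule antichains_mono[OF A]) (auto simp: B_def)
  then have lub: "least (antichain_completion L) B (Upper (antichain_completion L) Y)"
    unfolding YB by (rule least_Upper_singletons)
  show "\<not> least (antichain_completion L) A (Upper (antichain_completion L) Y)"
  proof
    assume "least (antichain_completion L) A (Upper (antichain_completion L) Y)"
    then have "B = A"
      by (rule completion.least_unique[OF lub])
    with Y YB show False by simp
  qed
qed

lemma irredundant_representation_unique:
  assumes irr: "irredundant_representation (antichain_completion L) X A"
  shows "X = {{x} | x. x \<in> A}"
proof -
  have lub: "least (antichain_completion L) A (Upper (antichain_completion L) X)"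
    and "\<And>C. C \<in> X \<Longrightarrow> join_irreducible (antichain_completion L) C"
    using irr unfolding irredundant_representation_def join_representation_def by simp_all
  then have sing: "\<And>C. C \<in> X \<Longrightarrow> \<exists>x\<in>carrier L. C = {x}"
    using singleton_if_join_irreducible by simp
  have X: "X \<in> antichains (antichain_completion L)"
    by (rule completion.irredundant_representation_antichain[OF irr])
  define S where "S = {x. {x} \<in> X}"
  have XS: "X = {{x} | x. x \<in> S}"
    using sing unfolding S_def by blast
  have S: "S \<subseteq> carrier L"
    using sing unfolding S_def by blast
  have "S \<in> antichains L"
  proof (rule antichainsI[OF S])
    fix x y assume xy: "x \<in> S" "y \<in> S" "x \<sqsubseteq> y"
    \<comment> \<open>Singletons are ordered like their points, so the antichain property descends
      from the family \<open>X\<close> to the point set \<open>S\<close>.\<close>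
    then have "{x} \<sqsubseteq>\<^bsub>antichain_completion L\<^esub> {y}"
      using S by (subst antichain_le_iff) (auto intro: singleton_antichain)
    then show "x = y"
      using antichainsD(2)[OF X, of "{x}" "{y}"] xy unfolding S_def by simp
  qed
  then have "least (antichain_completion L) S (Upper (antichain_completion L) X)"
    unfolding XS by (rule least_Upper_singletons)
  then have "A = S"
    by (rule completion.least_unique[OF lub])
  with XS show ?thesis by simp
qed

end

theorem theorem2:
  fixes P :: "('a, 'b) gorder_scheme"
  assumes "partial_order P"
  shows "upper_semilattice (antichain_completion P)
    \<and> (\<forall>A\<in>antichains P. \<forall>B\<in>antichains P.
          A \<squnion>\<^bsub>antichain_completion P\<^esub> B = maximal_elements P (A \<union> B))
    \<and> {A. join_irreducible (antichain_completion P) A} = {{x} | x. x \<in> carrier P}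
    \<and> (\<forall>A\<in>antichains P.
          A = \<Squnion>\<^bsub>antichain_completion P\<^esub> {{x} | x. x \<in> A}
          \<and> irredundant_representation (antichain_completion P) {{x} | x. x \<in> A} A
          \<and> (\<forall>X. irredundant_representation (antichain_completion P) X A
                  \<longrightarrow> X = {{x} | x. x \<in> A}))"
proof -
  interpret partial_order P by fact
  interpret completion: partial_order "antichain_completion P"
    by (rule partial_order_antichain_completion)
  show ?thesis
  proof (intro conjI ballI allI impI)
    show "{A. join_irreducible (antichain_completion P) A} = {{x} | x. x \<in> carrier P}"
      by (auto intro: join_irreducible_singleton dest: singleton_if_join_irreducible)
  next
    fix A assume "A \<in> antichains P"
    then show "A = \<Squnion>\<^bsub>antichain_completion P\<^esub> {{x} | x. x \<in> A}"
      by (rule completion.sup_eqI[OF least_Upper_singletons, symmetric])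
  qed (rule upper_semilattice_antichain_completion join_antichain_completion
      irredundant_representation_singletons irredundant_representation_unique; assumption)+
qed

end
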